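(* Let $(L,\delta,\alpha)$ and $(V,\mu,\alpha_V)$ be Hom-algebras. Then $(L\oplus V,d,\alpha\oplus\alpha_V)$ is a Hom-algebra with $V$ as an ideal if and only if $$d=\delta+\lambda_r+\lambda_l+\mu+\theta,$$ where $(\lambda_l,\lambda_r,\theta)$ is a $2$-cocycle of $L$ with values in $V$.
   Context: The base field $\mathbb K$ has characteristic zero. Put $M=L\oplus V$ and $\beta=\alpha\oplus\alpha_V$; $d$ is a bilinear map $M\times M\to M$. Fix one of the two types "left" or "right". For bilinear $f,g$ on a vector space $M$ with linear map $\beta\colon M\to M$ put, in the left case, $(f\circ g)(a,b,c)=f(g(a,b),\beta(c))+f(\beta(b),g(a,c))-f(\beta(a),g(b,c))$ and, in the right case, $(f\circ g)(a,b,c)=f(g(a,b),\beta(c))-f(g(a,c),\beta(b))-f(\beta(a),g(b,c))$; the $\beta$-Nijenhuis--Richardson bracket of $f$ and $g$ is $[f,g]=f\circ g+g\circ f$. Here a Hom-algebra is a triple $(M,d,\beta)$ with $M$ a vector space, $d$ bilinear and $\beta$ linear, which is multiplicative, $\beta(d(a,b))=d(\beta(a),\beta(b))$, and satisfies $[d,d]=0$; that is, it is a multiplicative Hom-Leibniz algebra of the fixed type (left: $d(\beta(a),d(b,c))=d(d(a,b),\beta(c))+d(\beta(b),d(a,c))$; right: $d(\beta(a),d(b,c))=d(d(a,b),\beta(c))-d(d(a,c),\beta(b))$). $V$ is an ideal of $M$ if $d(M,V)\subseteq V$, $d(V,M)\subseteq V$ and $\beta(V)\subseteq V$. Bilinear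 maps $\delta\colon L\times L\to L$, $\mu\colon V\times V\to V$, $\lambda_l\colon L\times V\to V$, $\lambda_r\colon V\times L\to V$, $\theta\colon L\times L\to V$ are viewed as bilinear maps on $M=L\oplus V$ by extending them by zero on the other components. A $2$-cocycle of $(L,\delta,\alpha)$ with values in $(V,\mu,\alpha_V)$ is a triple $(\lambda_l,\lambda_r,\theta)$ such that $2[\delta,\lambda_r+\lambda_l]+[\lambda_r+\lambda_l,\lambda_r+\lambda_l]+2[\mu,\theta]=0$, $[\mu,\lambda_r+\lambda_l]=0$, $[\delta+\lambda_r+\lambda_l,\theta]=0$, $\lambda_r\circ(\alpha_V\otimes\alpha)=\alpha_V\circ\lambda_r$, $\lambda_l\circ(\alpha\otimes\alpha_V)=\alpha_V\circ\lambda_l$, $\theta\circ(\alpha\otimes\alpha)=\alpha_V\circ\theta$.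
   Formalization: "Hom-algebra with V as an ideal" is supplemented by requiring that d restricts to μ on V and induces δ on L (the L-component of d on L×L is δ); without this the forward direction fails, e.g. for d=0 with δ nonzero. *)

theory Defs
  imports "HOL-Analysis.Product_Vector" "HOL-Library.Function_Algebras"
begin

definition bilinear_map ::
  "('k::field \<Rightarrow> 'a::ab_group_add \<Rightarrow> 'a) \<Rightarrow> ('k \<Rightarrow> 'b::ab_group_add \<Rightarrow> 'b) \<Rightarrow>
   ('k \<Rightarrow> 'c::ab_group_add \<Rightarrow> 'c) \<Rightarrow> ('a \<Rightarrow> 'b \<Rightarrow> 'c) \<Rightarrow> bool" where
  "bilinear_map sA sB sC f \<longleftrightarrow>
     (\<forall>a. Vector_Spaces.linear sB sC (f a)) \<and>
     (\<forall>b. Vector_Spaces.linear sA sC (\<lambda>a. f a b))"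

datatype leibniz_type = Left_Leibniz | Right_Leibniz

fun circ_product ::
  "leibniz_type \<Rightarrow> ('m::ab_group_add \<Rightarrow> 'm) \<Rightarrow> ('m \<Rightarrow> 'm \<Rightarrow> 'm) \<Rightarrow> ('m \<Rightarrow> 'm \<Rightarrow> 'm) \<Rightarrow>
   'm \<Rightarrow> 'm \<Rightarrow> 'm \<Rightarrow> 'm" where
  "circ_product Left_Leibniz \<beta> f g a b c =
     f (g a b) (\<beta> c) + f (\<beta> b) (g a c) - f (\<beta> a) (g b c)"
| "circ_product Right_Leibniz \<beta> f g a b c =
     f (g a b) (\<beta> c) - f (g a c) (\<beta> b) - f (\<beta> a) (g b c)"

text \<open>The \<open>\<beta>\<close>-Nijenhuis--Richardson bracket of two bilinear maps. Sums of maps and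
  the zero map are pointwise throughout.\<close>

definition NR_bracket ::
  "leibniz_type \<Rightarrow> ('m::ab_group_add \<Rightarrow> 'm) \<Rightarrow> ('m \<Rightarrow> 'm \<Rightarrow> 'm) \<Rightarrow> ('m \<Rightarrow> 'm \<Rightarrow> 'm) \<Rightarrow>
   'm \<Rightarrow> 'm \<Rightarrow> 'm \<Rightarrow> 'm" where
  "NR_bracket t \<beta> f g = circ_product t \<beta> f g + circ_product t \<beta> g f"

definition hom_algebra ::
  "leibniz_type \<Rightarrow> ('k::field \<Rightarrow> 'm::ab_group_add \<Rightarrow> 'm) \<Rightarrow> ('m \<Rightarrow> 'm \<Rightarrow> 'm) \<Rightarrow> ('m \<Rightarrow> 'm) \<Rightarrow> bool"
  where
  "hom_algebra t s d \<beta> \<longleftrightarrow>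
     vector_space s \<and> bilinear_map s s s d \<and> Vector_Spaces.linear s s \<beta> \<and>
     (\<forall>a b. \<beta> (d a b) = d (\<beta> a) (\<beta> b)) \<and>
     NR_bracket t \<beta> d d = 0"

definition hom_ideal ::
  "('k::field \<Rightarrow> 'm::ab_group_add \<Rightarrow> 'm) \<Rightarrow> ('m \<Rightarrow> 'm \<Rightarrow> 'm) \<Rightarrow> ('m \<Rightarrow> 'm) \<Rightarrow> 'm set \<Rightarrow> bool" where
  "hom_ideal s d \<beta> I \<longleftrightarrow>
     module.subspace s I \<and>
     (\<forall>m. \<forall>v\<in>I. d m v \<in> I) \<and> (\<forall>v\<in>I. \<forall>m. d v m \<in> I) \<and> (\<forall>v\<in>I. \<beta> v \<in> I)"

abbreviation sum_scale ::
  "('k::field \<Rightarrow> 'l::ab_group_add \<Rightarrow> 'l) \<Rightarrow> ('k \<Rightarrow> 'v::ab_group_add \<Rightarrow> 'v) \<Rightarrow>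
   'k \<Rightarrow> 'l \<times> 'v \<Rightarrow> 'l \<times> 'v" where
  "sum_scale \<equiv> module_prod.scale"

text \<open>Extensions by zero to \<open>L \<oplus> V\<close>, modelled as the product type. The two letters before the
  last name the components on which the map lives, the last letter its target component.\<close>

definition ext_LLL :: "('l \<Rightarrow> 'l \<Rightarrow> 'l) \<Rightarrow> 'l \<times> 'v \<Rightarrow> 'l \<times> 'v \<Rightarrow> 'l \<times> 'v::zero" where
  "ext_LLL f a b = (f (fst a) (fst b), 0)"

definition ext_VVV :: "('v \<Rightarrow> 'v \<Rightarrow> 'v) \<Rightarrow> 'l \<times> 'v \<Rightarrow> 'l \<times> 'v \<Rightarrow> 'l::zero \<times> 'v" where
  "ext_VVV f a b = (0, f (snd a) (snd b))"

definition ext_LVV :: "('l \<Rightarrow> 'v \<Rightarrow> 'v) \<Rightarrow> 'l \<times> 'v \<Rightarrow> 'l \<times> 'v \<Rightarrow> 'l::zero \<times> 'v" where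
  "ext_LVV f a b = (0, f (fst a) (snd b))"

definition ext_VLV :: "('v \<Rightarrow> 'l \<Rightarrow> 'v) \<Rightarrow> 'l \<times> 'v \<Rightarrow> 'l \<times> 'v \<Rightarrow> 'l::zero \<times> 'v" where
  "ext_VLV f a b = (0, f (snd a) (fst b))"

definition ext_LLV :: "('l \<Rightarrow> 'l \<Rightarrow> 'v) \<Rightarrow> 'l \<times> 'v \<Rightarrow> 'l \<times> 'v \<Rightarrow> 'l::zero \<times> 'v" where
  "ext_LLV f a b = (0, f (fst a) (fst b))"

definition two_cocycle ::
  "leibniz_type \<Rightarrow>
   ('k::field \<Rightarrow> 'l::ab_group_add \<Rightarrow> 'l) \<Rightarrow> ('l \<Rightarrow> 'l \<Rightarrow> 'l) \<Rightarrow> ('l \<Rightarrow> 'l) \<Rightarrow>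
   ('k \<Rightarrow> 'v::ab_group_add \<Rightarrow> 'v) \<Rightarrow> ('v \<Rightarrow> 'v \<Rightarrow> 'v) \<Rightarrow> ('v \<Rightarrow> 'v) \<Rightarrow>
   ('l \<Rightarrow> 'v \<Rightarrow> 'v) \<Rightarrow> ('v \<Rightarrow> 'l \<Rightarrow> 'v) \<Rightarrow> ('l \<Rightarrow> 'l \<Rightarrow> 'v) \<Rightarrow> bool" where
  "two_cocycle t sL \<delta> \<alpha> sV \<mu> \<alpha>V lam_l lam_r \<theta> \<longleftrightarrow>
     bilinear_map sL sV sV lam_l \<and> bilinear_map sV sL sV lam_r \<and> bilinear_map sL sL sV \<theta> \<and>
     (let br = NR_bracket t (map_prod \<alpha> \<alpha>V);
          dbl = (\<lambda>h a b c. sum_scale sL sV 2 (h a b c));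
          D = ext_LLL \<delta>; M = ext_VVV \<mu>; T = ext_LLV \<theta>;
          A = ext_VLV lam_r + ext_LVV lam_l
      in dbl (br D A) + br A A + dbl (br M T) = 0 \<and>
         br M A = 0 \<and>
         br (D + A) T = 0) \<and>
     (\<forall>v x. lam_r (\<alpha>V v) (\<alpha> x) = \<alpha>V (lam_r v x)) \<and>
     (\<forall>x v. lam_l (\<alpha> x) (\<alpha>V v) = \<alpha>V (lam_l x v)) \<and>
     (\<forall>x y. \<theta> (\<alpha> x) (\<alpha> y) = \<alpha>V (\<theta> x y))"

end

theory Submission
  imports Defs
begin

text \<open>
  Write \<open>\<beta> = \<alpha> \<oplus> \<alpha>V\<close> and \<open>\<circ>\<close> for the circle product.  Since \<open>[d, d] = 2 (d \<circ> d)\<close>, in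
  characteristic zero the Hom-Leibniz identity for \<open>d\<close> says that the trilinear map \<open>d \<circ> d\<close> vanishes.  Suppose \<open>d\<close> is the sum of its five components.  Expanding
  \<open>d \<circ> d\<close>, the products \<open>\<delta> \<circ> \<delta>\<close> and \<open>\<mu> \<circ> \<mu>\<close> vanish because \<open>L\<close> and \<open>V\<close> are Hom-algebras, and
  \<open>\<theta> \<circ> \<theta>\<close> and \<open>[\<delta>, \<mu>]\<close> vanish because the inner map has its values in a summand on which the
  outer one is zero.  What is left has values in \<open>V\<close> and splits by the number of arguments taken
  from \<open>V\<close>:
  with \<open>\<lambda> = \<lambda>\<^sub>r + \<lambda>\<^sub>l\<close>,

  \<^item> no argument: \<open>[\<delta> + \<lambda>, \<theta>]\<close>;
  \<^item> one argument: \<open>[\<delta>, \<lambda>] + \<lambda> \<circ> \<lambda> + [\<mu>, \<theta>]\<close>;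
  \<^item> two arguments: \<open>[\<mu>, \<lambda>]\<close>.

  These are the left-hand sides of the three bracket equations of a 2-cocycle (the middle one
  halved).  Multiplying the \<open>V\<close>-components of all arguments by a scalar \<open>k\<close> multiplies them by \<open>1\<close>, \<open>k\<close>
  and \<open>k\<^sup>2\<close>, so their sum vanishes identically only if each of them does: \<open>k = 0\<close> isolates the first,
  and then \<open>k = 1\<close> and \<open>k = -1\<close> separate the other two (\<open>circ_product_eq_0_iff\<close>).
  Likewise \<open>\<beta>\<close> is multiplicative for \<open>d\<close> iff it is so for each component
  (\<open>multiplicative_iff\<close>).  Hence a sum of five components is a Hom-algebra structure iff the three
  mixed ones form a 2-cocycle (\<open>hom_algebra_iff_two_cocycle\<close>).

  Finally, that \<open>V\<close> is an ideal means that \<open>d\<close> has no component with an argument in \<open>V\<close> and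
  value in \<open>L\<close>, and such a \<open>d\<close> is the sum of the remaining five
  (\<open>bilinear_map_eq_sum_of_components\<close>).
\<close>

section \<open>Bilinear maps and Hom-algebras\<close>

lemma bilinear_map_iff:
  assumes "vector_space sA" "vector_space sB" "vector_space sC"
  shows "bilinear_map sA sB sC f \<longleftrightarrow>
    (\<forall>a b b'. f a (b + b') = f a b + f a b') \<and> (\<forall>k a b. f a (sB k b) = sC k (f a b)) \<and>
    (\<forall>a a' b. f (a + a') b = f a b + f a' b) \<and> (\<forall>k a b. f (sA k a) b = sC k (f a b))"
  using assms by (auto simp: bilinear_map_def Vector_Spaces.linear_iff)

lemma
  assumes "bilinear_map sA sB sC f"
  shows bilinear_map_add: "f a (b + b') = f a b + f a b'" "f (a + a') b = f a b + f a' b"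
    and bilinear_map_scale: "f a (sB k b) = sC k (f a b)" "f (sA k a) b = sC k (f a b)"
  using assms by (auto simp: bilinear_map_def Vector_Spaces.linear_iff)

lemma bilinear_map_zero:
  assumes "bilinear_map sA sB sC f"
  shows "f a 0 = 0" "f 0 b = 0"
  using bilinear_map_add(1)[OF assms, of a 0 0] bilinear_map_add(2)[OF assms, of 0 0 b] by simp_all

lemma bilinear_map_comp_linear:
  assumes "bilinear_map sA sB sC f"
    and "Vector_Spaces.linear sA' sA g" "Vector_Spaces.linear sB' sB h"
    and "Vector_Spaces.linear sC sC' p"
  shows "bilinear_map sA' sB' sC' (\<lambda>a b. p (f (g a) (h b)))"
  using assms by (simp add: bilinear_map_def Vector_Spaces.linear_iff)

lemma (in vector_space) scale_two: "scale 2 x = x + x"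
  using scale_left_distrib[of 1 1 x] by simp

lemma vector_space_double_eq_0_iff:
  fixes s :: "'k::field_char_0 \<Rightarrow> 'm::ab_group_add \<Rightarrow> 'm" and x :: 'm
  assumes "vector_space s"
  shows "x + x = 0 \<longleftrightarrow> x = 0"
proof -
  interpret vector_space s by fact
  show ?thesis using scale_two[of x] scale_eq_0_iff[of 2 x] by simp
qed

lemma NR_bracket_self_eq_0_iff:
  fixes s :: "'k::field_char_0 \<Rightarrow> 'm::ab_group_add \<Rightarrow> 'm" and d :: "'m \<Rightarrow> 'm \<Rightarrow> 'm"
  assumes "vector_space s"
  shows "NR_bracket t \<beta> d d = 0 \<longleftrightarrow> (\<forall>a b c. circ_product t \<beta> d d a b c = 0)"
  using vector_space_double_eq_0_iff[OF assms] by (simp add: NR_bracket_def fun_eq_iff)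

section \<open>Components of a bilinear map on a direct sum\<close>

context vector_space_prod
begin

lemma fst_scale [simp]: "fst (scale k p) = s1 k (fst p)"
  and snd_scale [simp]: "snd (scale k p) = s2 k (snd p)"
  by (simp_all add: scale_def)

lemma linear_Pair_0: "Vector_Spaces.linear s1 scale (\<lambda>x. (x, 0))"
  and linear_0_Pair: "Vector_Spaces.linear s2 scale (\<lambda>v. (0, v))"
  by (simp_all add: Vector_Spaces.linear_iff vs1.vector_space_axioms vs2.vector_space_axioms
      p.vector_space_axioms scale_prod)

lemma bilinear_map_eq_sum_of_components:
  fixes d :: "'b \<times> 'c \<Rightarrow> 'b \<times> 'c \<Rightarrow> 'b \<times> 'c"
  assumes bil: "bilinear_map scale scale scale d"
    and ideal: "\<And>m v. fst (d m (0, v)) = 0" "\<And>m v. fst (d (0, v) m) = 0"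
    and \<mu>: "\<And>v w. d (0, v) (0, w) = (0, \<mu> v w)"
    and \<delta>: "\<And>x y. fst (d (x, 0) (y, 0)) = \<delta> x y"
  shows "d = ext_LLL \<delta> + ext_VLV (\<lambda>v x. snd (d (0, v) (x, 0))) +
    ext_LVV (\<lambda>x v. snd (d (x, 0) (0, v))) + ext_VVV \<mu> + ext_LLV (\<lambda>x y. snd (d (x, 0) (y, 0)))"
proof (intro ext)
  fix a b :: "'b \<times> 'c"
  obtain x v y w where ab: "a = (x, v)" "b = (y, w)"
    by (metis surj_pair)
  \<comment> \<open>the four summands supply \<open>\<delta>\<close> and \<open>\<theta>\<close> together, then \<open>\<lambda>\<^sub>r\<close>, \<open>\<lambda>\<^sub>l\<close> and \<open>\<mu>\<close>\<close>
  have "d a b = d ((x, 0) + (0, v)) ((y, 0) + (0, w))"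
    by (simp add: ab)
  also have "\<dots> = d (x, 0) (y, 0) + d (0, v) (y, 0) + d (x, 0) (0, w) + d (0, v) (0, w)"
    unfolding bilinear_map_add[OF bil] by (simp add: algebra_simps)
  finally show "d a b = (ext_LLL \<delta> + ext_VLV (\<lambda>v x. snd (d (0, v) (x, 0))) +
    ext_LVV (\<lambda>x v. snd (d (x, 0) (0, v))) + ext_VVV \<mu> +
    ext_LLV (\<lambda>x y. snd (d (x, 0) (y, 0)))) a b"
    by (simp add: ab prod_eq_iff ideal \<mu> \<delta> algebra_simps
        ext_LLL_def ext_VVV_def ext_LVV_def ext_VLV_def ext_LLV_def)
qed

end

section \<open>Sums of five components and 2-cocycles\<close>

locale leibniz_components = vector_space_prod s1 s2
  for s1 :: "'k::field_char_0 \<Rightarrow> 'l::ab_group_add \<Rightarrow> 'l"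
    and s2 :: "'k \<Rightarrow> 'v::ab_group_add \<Rightarrow> 'v" +
  fixes t :: leibniz_type
    and \<delta> :: "'l \<Rightarrow> 'l \<Rightarrow> 'l" and \<alpha> :: "'l \<Rightarrow> 'l" and \<mu> :: "'v \<Rightarrow> 'v \<Rightarrow> 'v" and \<alpha>V :: "'v \<Rightarrow> 'v"
    and lam_l :: "'l \<Rightarrow> 'v \<Rightarrow> 'v" and lam_r :: "'v \<Rightarrow> 'l \<Rightarrow> 'v" and \<theta> :: "'l \<Rightarrow> 'l \<Rightarrow> 'v"
  assumes hom_L: "hom_algebra t s1 \<delta> \<alpha>" and hom_V: "hom_algebra t s2 \<mu> \<alpha>V"
    and lam_l: "bilinear_map s1 s2 s2 lam_l" and lam_r: "bilinear_map s2 s1 s2 lam_r"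
    and \<theta>: "bilinear_map s1 s1 s2 \<theta>"
begin

abbreviation "\<beta> \<equiv> map_prod \<alpha> \<alpha>V"
abbreviation "D \<equiv> ext_LLL \<delta> :: 'l \<times> 'v \<Rightarrow> 'l \<times> 'v \<Rightarrow> 'l \<times> 'v"
abbreviation "M \<equiv> ext_VVV \<mu> :: 'l \<times> 'v \<Rightarrow> 'l \<times> 'v \<Rightarrow> 'l \<times> 'v"
abbreviation "T \<equiv> ext_LLV \<theta> :: 'l \<times> 'v \<Rightarrow> 'l \<times> 'v \<Rightarrow> 'l \<times> 'v"
abbreviation "A \<equiv> ext_VLV lam_r + ext_LVV lam_l :: 'l \<times> 'v \<Rightarrow> 'l \<times> 'v \<Rightarrow> 'l \<times> 'v"
abbreviation "br \<equiv> NR_bracket t \<beta>"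
abbreviation "d \<equiv> ext_LLL \<delta> + ext_VLV lam_r + ext_LVV lam_l + ext_VVV \<mu> + ext_LLV \<theta>"

text \<open>For \<open>n \<le> 2\<close> this is the part of \<open>d \<circ> d\<close> with \<open>n\<close> arguments from \<open>V\<close> and values in \<open>V\<close>.  It is
  \<open>A \<circ> A\<close>, half of \<open>[A, A]\<close>, that occurs in it, whence the factors 2 in the first equation of a
  2-cocycle.\<close>

definition defect :: "nat \<Rightarrow> 'l \<times> 'v \<Rightarrow> 'l \<times> 'v \<Rightarrow> 'l \<times> 'v \<Rightarrow> 'l \<times> 'v" where
  "defect n = (if n = 0 then br (D + A) T
     else if n = 1 then br D A + circ_product t \<beta> A A + br M T
     else br M A)"

lemma \<delta>: "bilinear_map s1 s1 s1 \<delta>" and \<mu>: "bilinear_map s2 s2 s2 \<mu>"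
  and linear_\<alpha>: "Vector_Spaces.linear s1 s1 \<alpha>" and linear_\<alpha>V: "Vector_Spaces.linear s2 s2 \<alpha>V"
  and circ_L: "circ_product t \<alpha> \<delta> \<delta> x y z = 0" and circ_V: "circ_product t \<alpha>V \<mu> \<mu> u v w = 0"
  using hom_L hom_V NR_bracket_self_eq_0_iff[OF vs1.vector_space_axioms]
    NR_bracket_self_eq_0_iff[OF vs2.vector_space_axioms]
  by (simp_all add: hom_algebra_def)

lemmas component_zero = \<delta>[THEN bilinear_map_zero(1)] \<delta>[THEN bilinear_map_zero(2)]
  \<mu>[THEN bilinear_map_zero(1)] \<mu>[THEN bilinear_map_zero(2)]
  lam_l[THEN bilinear_map_zero(1)] lam_l[THEN bilinear_map_zero(2)]
  lam_r[THEN bilinear_map_zero(1)] lam_r[THEN bilinear_map_zero(2)]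
  \<theta>[THEN bilinear_map_zero(1)] \<theta>[THEN bilinear_map_zero(2)]

lemmas component_add = \<delta>[THEN bilinear_map_add(1)] \<delta>[THEN bilinear_map_add(2)]
  \<mu>[THEN bilinear_map_add(1)] \<mu>[THEN bilinear_map_add(2)]
  lam_l[THEN bilinear_map_add(1)] lam_l[THEN bilinear_map_add(2)]
  lam_r[THEN bilinear_map_add(1)] lam_r[THEN bilinear_map_add(2)]
  \<theta>[THEN bilinear_map_add(1)] \<theta>[THEN bilinear_map_add(2)]

lemmas component_scale = \<delta>[THEN bilinear_map_scale(1)] \<delta>[THEN bilinear_map_scale(2)]
  \<mu>[THEN bilinear_map_scale(1)] \<mu>[THEN bilinear_map_scale(2)]
  lam_l[THEN bilinear_map_scale(1)] lam_l[THEN bilinear_map_scale(2)]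
  lam_r[THEN bilinear_map_scale(1)] lam_r[THEN bilinear_map_scale(2)]
  \<theta>[THEN bilinear_map_scale(1)] \<theta>[THEN bilinear_map_scale(2)]

lemmas ext_defs = ext_LLL_def ext_VVV_def ext_LVV_def ext_VLV_def ext_LLV_def

lemma bilinear_map_d: "bilinear_map scale scale scale d"
  by (simp add: bilinear_map_iff p.vector_space_axioms prod_eq_iff ext_defs
      component_add component_scale algebra_simps)

text \<open>The map \<open>\<beta>\<close> respects the two summands, so the identity can be tested on pairs of vectors from
  \<open>L\<close> or \<open>V\<close>, and each kind of pair sees only its own components of \<open>d\<close>; the pairs from \<open>L\<close> see two,
  which are told apart by their target.\<close>

lemma multiplicative_iff:
  "(\<forall>a b. \<beta> (d a b) = d (\<beta> a) (\<beta> b)) \<longleftrightarrow>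
    (\<forall>v x. lam_r (\<alpha>V v) (\<alpha> x) = \<alpha>V (lam_r v x)) \<and>
    (\<forall>x v. lam_l (\<alpha> x) (\<alpha>V v) = \<alpha>V (lam_l x v)) \<and>
    (\<forall>x y. \<theta> (\<alpha> x) (\<alpha> y) = \<alpha>V (\<theta> x y))" (is "?L \<longleftrightarrow> ?R")
proof
  interpret a: Vector_Spaces.linear s1 s1 \<alpha> by (fact linear_\<alpha>)
  interpret av: Vector_Spaces.linear s2 s2 \<alpha>V by (fact linear_\<alpha>V)
  show ?R if ?L
  proof (intro conjI allI)
    note L = that[rule_format]
    show "\<theta> (\<alpha> x) (\<alpha> y) = \<alpha>V (\<theta> x y)" for x y
      using L[of "(x, 0)" "(y, 0)"] by (simp add: ext_defs component_zero)
    show "lam_r (\<alpha>V v) (\<alpha> x) = \<alpha>V (lam_r v x)" "lam_l (\<alpha> x) (\<alpha>V v) = \<alpha>V (lam_l x v)" for x v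
      using L[of "(0, v)" "(x, 0)"] L[of "(x, 0)" "(0, v)"]
      by (simp_all add: ext_defs component_zero)
  qed
  show ?L if ?R
    using that hom_L hom_V by (simp add: ext_defs av.add hom_algebra_def)
qed

lemma circ_product_eq_sum_defect:
  "circ_product t \<beta> d d a b c = defect 0 a b c + defect 1 a b c + defect 2 a b c"
  unfolding defect_def
  using circ_L[of "fst a" "fst b" "fst c"] circ_V[of "snd a" "snd b" "snd c"]
  by (cases t)
    (simp_all add: NR_bracket_def prod_eq_iff ext_defs component_zero component_add
      algebra_simps)

text \<open>Every term of \<open>defect n\<close> is multilinear and uses exactly \<open>n\<close> of the three \<open>V\<close>-components as
  inputs, possibly after applying \<open>\<alpha>V\<close>, which commutes with scaling.  All its values lie in \<open>V\<close>,
  so scaling the whole pair is the same as scaling its \<open>V\<close>-component.\<close>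

lemma defect_homogeneous:
  assumes n: "n \<le> 2" and \<phi>: "\<phi> = map_prod id (s2 k)"
  shows "defect n (\<phi> a) (\<phi> b) (\<phi> c) = scale (k ^ n) (defect n a b c)"
proof -
  interpret av: Vector_Spaces.linear s2 s2 \<alpha>V by (fact linear_\<alpha>V)
  from n consider "n = 0" | "n = 1" | "n = 2"
    by linarith
  then show ?thesis
    unfolding defect_def
    by cases (cases t; simp add: \<phi> NR_bracket_def prod_eq_iff ext_defs av.scale
      component_zero component_add component_scale algebra_simps power2_eq_square)+
qed

lemma circ_product_eq_0_iff:
  "(\<forall>a b c. circ_product t \<beta> d d a b c = 0) \<longleftrightarrow> defect 0 = 0 \<and> defect 1 = 0 \<and> defect 2 = 0"
proof
  assume "\<forall>a b c. circ_product t \<beta> d d a b c = 0"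
  then have sum: "defect 0 a b c + defect 1 a b c + defect 2 a b c = 0" for a b c
    unfolding circ_product_eq_sum_defect by blast
  have scaled: "defect 0 a b c + scale k (defect 1 a b c) + scale (k ^ 2) (defect 2 a b c) = 0"
    for k a b c
    using sum[of "map_prod id (s2 k) a" "map_prod id (s2 k) b" "map_prod id (s2 k) c"]
    by (simp add: defect_homogeneous[where k = k, OF _ refl])
  have 0: "defect 0 a b c = 0" for a b c
    using scaled[where k = 0] by simp
  have 1: "defect 1 a b c = defect 2 a b c" for a b c
    using scaled[where k = "- 1", of a b c] by (simp add: 0)
  have 2: "defect 2 a b c = 0" for a b c
    using sum[of a b c] unfolding 0 1 add_0_left
      vector_space_double_eq_0_iff[OF p.vector_space_axioms] .
  show "defect 0 = 0 \<and> defect 1 = 0 \<and> defect 2 = 0"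
    using 0 1 2 by (simp add: fun_eq_iff)
qed (simp add: circ_product_eq_sum_defect)

theorem hom_algebra_iff_two_cocycle:
  "hom_algebra t scale d \<beta> \<longleftrightarrow> two_cocycle t s1 \<delta> \<alpha> s2 \<mu> \<alpha>V lam_l lam_r \<theta>"
proof -
  interpret a: Vector_Spaces.linear s1 s1 \<alpha> by (fact linear_\<alpha>)
  interpret av: Vector_Spaces.linear s2 s2 \<alpha>V by (fact linear_\<alpha>V)
  have linear_\<beta>: "Vector_Spaces.linear scale scale \<beta>"
    by (simp add: Vector_Spaces.linear_iff p.vector_space_axioms prod_eq_iff
        a.add a.scale av.add av.scale)
  \<comment> \<open>left of the first cocycle equation stands twice the part of \<open>d \<circ> d\<close> with one argument from \<open>V\<close>\<close>
  have double: "(\<lambda>a b c. scale 2 (br D A a b c)) + br A A + (\<lambda>a b c. scale 2 (br M T a b c))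
      = defect 1 + defect 1"
    by (simp add: fun_eq_iff defect_def NR_bracket_def p.scale_two algebra_simps)
  have double_0: "defect 1 + defect 1 = 0 \<longleftrightarrow> defect 1 = 0"
    unfolding fun_eq_iff plus_fun_apply zero_fun_apply
      vector_space_double_eq_0_iff[OF p.vector_space_axioms] ..
  have "hom_algebra t scale d \<beta> \<longleftrightarrow>
      (\<forall>a b. \<beta> (d a b) = d (\<beta> a) (\<beta> b)) \<and> defect 0 = 0 \<and> defect 1 = 0 \<and> defect 2 = 0"
    unfolding hom_algebra_def NR_bracket_self_eq_0_iff[OF p.vector_space_axioms]
      circ_product_eq_0_iff
    using p.vector_space_axioms bilinear_map_d linear_\<beta> by blast
  also have "\<dots> \<longleftrightarrow> two_cocycle t s1 \<delta> \<alpha> s2 \<mu> \<alpha>V lam_l lam_r \<theta>"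
    unfolding two_cocycle_def Let_def double double_0 multiplicative_iff
    using lam_l lam_r \<theta> by (auto simp: defect_def)
  finally show ?thesis .
qed

lemma hom_ideal_d: "hom_ideal scale d \<beta> ({0} \<times> UNIV)"
proof -
  interpret a: Vector_Spaces.linear s1 s1 \<alpha> by (fact linear_\<alpha>)
  have "p.subspace ({0} \<times> UNIV)"
    by (rule subspace_Times) simp_all
  then show ?thesis
    by (auto simp: hom_ideal_def ext_defs component_zero prod_eq_iff)
qed

end

theorem theorem5p1:
  fixes t :: leibniz_type
    and sL :: "'k::field_char_0 \<Rightarrow> 'l::ab_group_add \<Rightarrow> 'l"
    and sV :: "'k \<Rightarrow> 'v::ab_group_add \<Rightarrow> 'v"
    and \<delta> :: "'l \<Rightarrow> 'l \<Rightarrow> 'l" and \<alpha> :: "'l \<Rightarrow> 'l"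
    and \<mu> :: "'v \<Rightarrow> 'v \<Rightarrow> 'v" and \<alpha>V :: "'v \<Rightarrow> 'v"
    and d :: "'l \<times> 'v \<Rightarrow> 'l \<times> 'v \<Rightarrow> 'l \<times> 'v"
  assumes "hom_algebra t sL \<delta> \<alpha>"
    and "hom_algebra t sV \<mu> \<alpha>V"
    and "bilinear_map (sum_scale sL sV) (sum_scale sL sV) (sum_scale sL sV) d"
  shows
    "(hom_algebra t (sum_scale sL sV) d (map_prod \<alpha> \<alpha>V) \<and>
      hom_ideal (sum_scale sL sV) d (map_prod \<alpha> \<alpha>V) ({0} \<times> UNIV) \<and>
      (\<forall>v w. d (0, v) (0, w) = (0, \<mu> v w)) \<and>
      (\<forall>x y. fst (d (x, 0) (y, 0)) = \<delta> x y)) \<longleftrightarrow>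
     (\<exists>lam_l lam_r \<theta>. two_cocycle t sL \<delta> \<alpha> sV \<mu> \<alpha>V lam_l lam_r \<theta> \<and>
        d = ext_LLL \<delta> + ext_VLV lam_r + ext_LVV lam_l + ext_VVV \<mu> + ext_LLV \<theta>)"
    (is "?ext \<longleftrightarrow> ?cocycle")
proof -
  interpret sum: vector_space_prod sL sV
    using assms(1,2) by (simp add: hom_algebra_def vector_space_prod_def vector_space_pair_def)
  show ?thesis
  proof
    assume ext: ?ext
    define lam_l where "lam_l = (\<lambda>x v. snd (d (x, 0) (0, v)))"
    define lam_r where "lam_r = (\<lambda>v x. snd (d (0, v) (x, 0)))"
    define \<theta> where "\<theta> = (\<lambda>x y. snd (d (x, 0) (y, 0)))"
    interpret leibniz_components sL sV t \<delta> \<alpha> \<mu> \<alpha>V lam_l lam_r \<theta>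
      unfolding lam_l_def lam_r_def \<theta>_def
      by unfold_locales (fact assms(1,2)
          bilinear_map_comp_linear[OF assms(3) sum.linear_Pair_0 sum.linear_0_Pair sum.linear_snd]
          bilinear_map_comp_linear[OF assms(3) sum.linear_0_Pair sum.linear_Pair_0 sum.linear_snd]
          bilinear_map_comp_linear[OF assms(3) sum.linear_Pair_0 sum.linear_Pair_0 sum.linear_snd])+
    have "d m (0, v) \<in> {0} \<times> UNIV" "d (0, v) m \<in> {0} \<times> UNIV" for m v
      using ext unfolding hom_ideal_def by blast+
    then have d: "d = ext_LLL \<delta> + ext_VLV lam_r + ext_LVV lam_l + ext_VVV \<mu> + ext_LLV \<theta>"
      unfolding lam_l_def lam_r_def \<theta>_def
      using ext by (intro sum.bilinear_map_eq_sum_of_components[OF assms(3)])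
        (auto simp: mem_Times_iff)
    moreover have "two_cocycle t sL \<delta> \<alpha> sV \<mu> \<alpha>V lam_l lam_r \<theta>"
      using ext hom_algebra_iff_two_cocycle by (simp add: d[symmetric])
    ultimately show ?cocycle
      by blast
  next
    assume ?cocycle
    then obtain lam_l lam_r \<theta>
      where cocycle: "two_cocycle t sL \<delta> \<alpha> sV \<mu> \<alpha>V lam_l lam_r \<theta>"
        and d: "d = ext_LLL \<delta> + ext_VLV lam_r + ext_LVV lam_l + ext_VVV \<mu> + ext_LLV \<theta>"
      by blast
    interpret leibniz_components sL sV t \<delta> \<alpha> \<mu> \<alpha>V lam_l lam_r \<theta>
      using assms(1,2) cocycle by unfold_locales (simp_all add: two_cocycle_def)
    show ?ext
      unfolding d using cocycle hom_algebra_iff_two_cocycle hom_ideal_d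
      by (simp add: ext_defs component_zero)
  qed
qed

end
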